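(* (Generalized Imhof relation, without wall restriction.) Let $N\ge1$ and $\ell\ge1$ be integers, $T>0$, and $0=t_0<t_1<\cdots<t_\ell=T$. Then for all $\mathbf{y}_1,\dots,\mathbf{y}_\ell\in\mathbf{R}^N_<$, with $\mathbf{y}_0=\mathbf{0}$, $$\prod_{i=1}^{\ell}g_N^T(t_{i-1},\mathbf{y}_{i-1},t_i,\mathbf{y}_i)=\overline{c}_N\,T^{N(N-1)/4}\left(\prod_{i=1}^{\ell}p_N(t_{i-1},\mathbf{y}_{i-1},t_i,\mathbf{y}_i)\right)\frac{1}{h_N(\mathbf{y}_\ell)},$$ where $$\overline{c}_N=\pi^{N/2}\prod_{j=1}^N\frac{\Gamma(j)}{\Gamma(j/2)}.$$
   Context: $\mathbf{R}^N_<=\{\mathbf{x}\in\mathbf{R}^N:x_1<x_2<\cdots<x_N\}$ and $h_N(\mathbf{x})=\prod_{1\le i<j\le N}(x_j-x_i)$. For $t>0$, $\mathbf{x},\mathbf{y}\in\mathbf{R}^N_<$, $$f_N(t,\mathbf{y}|\mathbf{x})=\det_{1\le i,j\le N}\left((2\pi t)^{-1/2}e^{-(x_j-y_i)^2/2t}\right),\qquad\mathcal{N}_N(t,\mathbf{x})=\int_{\mathbf{R}^N_<}f_N(t,\mathbf{y}|\mathbf{x})\,d\mathbf{y},\qquad\mathcal{N}_N(0,\mathbf{x})=1.$$ The densities $g_N^T$ (for $0\le s<t\le T$) and $p_N$ (for $0\le s<t<\infty$), with $\mathbf{x},\mathbf{y}\in\mathbf{R}^N_<$, are $$g_N^T(0,\mathbf{0},t,\mathbf{y})=c_NT^{N(N-1)/4}t^{-N^2/2}e^{-|\mathbf{y}|^2/2t}h_N(\mathbf{y})\mathcal{N}_N(T-t,\mathbf{y}),\qquad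 g_N^T(s,\mathbf{x},t,\mathbf{y})=\frac{f_N(t-s,\mathbf{y}|\mathbf{x})\mathcal{N}_N(T-t,\mathbf{y})}{\mathcal{N}_N(T-s,\mathbf{x})},$$ $$p_N(0,\mathbf{0},t,\mathbf{y})=c'_Nt^{-N^2/2}e^{-|\mathbf{y}|^2/2t}h_N(\mathbf{y})^2,\qquad p_N(s,\mathbf{x},t,\mathbf{y})=\frac{1}{h_N(\mathbf{x})}f_N(t-s,\mathbf{y}|\mathbf{x})h_N(\mathbf{y}),$$ where $c_N=2^{-N/2}/\prod_{j=1}^N\Gamma(j/2)$ and $c'_N=(2\pi)^{-N/2}/\prod_{j=1}^N\Gamma(j)$. *)

theory Defs
  imports "HOL-Analysis.Analysis"
begin

(* R^N is real ^ 'n with 'n a finite linearly ordered index type, so that N = CARD('n) >= 1 and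
   the order of 'n plays the role of the order 1 < 2 < ... < N of the coordinate indices. *)

definition weyl_chamber :: "(real ^ 'n::{finite,linorder}) set" where
  "weyl_chamber = {x. \<forall>i j. i < j \<longrightarrow> x $ i < x $ j}"

definition vandermonde :: "real ^ 'n::{finite,linorder} \<Rightarrow> real" where
  "vandermonde x = (\<Prod>(i, j)\<in>{(i, j). i < j}. x $ j - x $ i)"

(* km_density t y x is the Karlin-McGregor determinant f_N(t, y | x), only meant for t > 0. *)
definition km_density :: "real \<Rightarrow> real ^ 'n::{finite,linorder} \<Rightarrow> real ^ 'n::{finite,linorder} \<Rightarrow> real" where
  "km_density t y x =
     det (\<chi> i j. (2 * pi * t) powr (- 1 / 2) * exp (- ((x $ j - y $ i)\<^sup>2) / (2 * t)))"

definition noncolliding_prob :: "real \<Rightarrow> real ^ 'n::{finite,linorder} \<Rightarrow> real" where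
  "noncolliding_prob t x =
     (if t = 0 then 1
      else set_lebesgue_integral lborel weyl_chamber (\<lambda>y. km_density t y x))"

definition c_const :: "nat \<Rightarrow> real" where
  "c_const N = 2 powr (- real N / 2) / (\<Prod>j=1..N. Gamma (real j / 2))"

definition c'_const :: "nat \<Rightarrow> real" where
  "c'_const N = (2 * pi) powr (- real N / 2) / (\<Prod>j=1..N. Gamma (real j))"

definition cbar_const :: "nat \<Rightarrow> real" where
  "cbar_const N = pi powr (real N / 2) * (\<Prod>j=1..N. Gamma (real j) / Gamma (real j / 2))"

(* The transition densities g_N^T(s, x, t, y) and p_N(s, x, t, y), only meant for 0 <= s < t
   (and t <= T for the former), y in the Weyl chamber, and x in the Weyl chamber or
   (s, x) = (0, 0). For N = 1 the origin lies in the Weyl chamber; there both formulas for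
   (s, x) = (0, 0) have the same value, so that the order of the case distinction is
   immaterial. *)

definition g_density ::
  "real \<Rightarrow> real \<Rightarrow> real ^ 'n::{finite,linorder} \<Rightarrow> real \<Rightarrow> real ^ 'n::{finite,linorder} \<Rightarrow> real" where
  "g_density T s x t y =
     (if s = 0 \<and> x = 0
      then c_const CARD('n) * T powr (real CARD('n) * (real CARD('n) - 1) / 4)
             * t powr (- (real CARD('n))\<^sup>2 / 2) * exp (- (norm y)\<^sup>2 / (2 * t))
             * vandermonde y * noncolliding_prob (T - t) y
      else km_density (t - s) y x * noncolliding_prob (T - t) y
             / noncolliding_prob (T - s) x)"

definition p_density ::
  "real \<Rightarrow> real ^ 'n::{finite,linorder} \<Rightarrow> real \<Rightarrow> real ^ 'n::{finite,linorder} \<Rightarrow> real" where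
  "p_density s x t y =
     (if s = 0 \<and> x = 0
      then c'_const CARD('n) * t powr (- (real CARD('n))\<^sup>2 / 2)
             * exp (- (norm y)\<^sup>2 / (2 * t)) * (vandermonde y)\<^sup>2
      else 1 / vandermonde x * km_density (t - s) y x * vandermonde y)"

end

theory Submission
  imports Defs "HOL-Probability.Distributions"
begin

text \<open>
  Multiplying \<open>g\<close> by \<open>h(y)/h(x)\<close> and dividing by \<open>N(T - t, y)/N(T - s, x)\<close> turns it into \<open>p\<close>, so
  that both products telescope. The telescoping needs that \<open>N(T - t, y)\<close> does not vanish
  at the intermediate times. This is a consequence of the strict total positivity of the Gaussian
  kernel, i.e. of \<open>det (exp (a\<^sub>i b\<^sub>j)) > 0\<close> for increasing \<open>a\<close>, \<open>b\<close>: the determinant does not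
  vanish because a nontrivial combination of \<open>n\<close> exponentials has fewer than \<open>n\<close> zeros (Rolle), and
  it is positive on the path \<open>b + s a\<close> for large \<open>s\<close>, where the diagonal term dominates.
\<close>

section \<open>Strict total positivity of the kernel \<open>exp (a * b)\<close>\<close>

lemma Rolle_finite:
  fixes f f' :: "real \<Rightarrow> real"
  assumes "finite S" and zero: "\<And>s. s \<in> S \<Longrightarrow> f s = 0"
    and deriv: "\<And>s. (f has_real_derivative f' s) (at s)"
  shows "\<exists>S'. finite S' \<and> card S \<le> Suc (card S') \<and> (\<forall>s\<in>S'. f' s = 0)"
proof -
  \<comment> \<open>The induction carries the extra claim that every zero in \<open>S'\<close> lies
    strictly below some point of \<open>S\<close>. The Rolle point found between
    \<open>Max S\<close> and a new maximum \<open>b\<close> is then not yet in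
    \<open>S'\<close>.\<close>
  have "\<exists>S'. finite S' \<and> card S \<le> Suc (card S') \<and> (\<forall>s\<in>S'. f' s = 0 \<and> (\<exists>u\<in>S. s < u))"
    using assms(1,2)
  proof (induction S rule: finite_linorder_max_induct)
    case empty
    show ?case by (intro exI[of _ "{}"]) auto
  next
    case (insert b S)
    obtain S' where S': "finite S'" "card S \<le> Suc (card S')"
      "\<forall>s\<in>S'. f' s = 0 \<and> (\<exists>u\<in>S. s < u)"
      using insert by auto
    show ?case
    proof (cases "S = {}")
      case True
      then show ?thesis by (intro exI[of _ "{}"]) auto
    next
      case False
      define a where "a = Max S"
      have a: "a \<in> S" "\<And>u. u \<in> S \<Longrightarrow> u \<le> a" "a < b"
        using False insert.hyps by (auto simp: a_def)
      have "\<exists>z>a. z < b \<and> (f has_real_derivative 0) (at z)"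
      proof (rule Rolle[OF a(3)])
        show "f a = f b" using a(1) insert.prems by simp
        show "continuous_on {a..b} f"
          using deriv DERIV_isCont by (blast intro: continuous_at_imp_continuous_on)
        show "f differentiable (at z)" for z
          using deriv real_differentiable_def by blast
      qed
      then obtain z where z: "a < z" "z < b" "(f has_real_derivative 0) (at z)" by blast
      then have "f' z = 0" using deriv DERIV_unique by blast
      moreover have "z \<notin> S'" using S'(3) a(2) z(1) by force
      ultimately show ?thesis
        using S' z a insert.hyps
        by (intro exI[of _ "insert z S'"]) auto
    qed
  qed
  then show ?thesis by blast
qed

text \<open>Dividing by \<open>exp (a k * s)\<close> keeps the zeros and makes the
  \<open>k\<close>-th term constant. Differentiation removes that term and, by Rolle, costs at most
  one zero, so induction applies to the coefficients \<open>c i * (a i - a k)\<close>.\<close>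

lemma exp_sum_zeros:
  fixes a c :: "'i \<Rightarrow> real"
  assumes "finite I" and "inj_on a I" and "finite S" and "card I \<le> card S"
    and "\<And>s. s \<in> S \<Longrightarrow> (\<Sum>i\<in>I. c i * exp (a i * s)) = 0"
  shows "\<forall>i\<in>I. c i = 0"
  using assms
proof (induction I arbitrary: a c S rule: finite_induct)
  case empty
  then show ?case by simp
next
  case (insert k I)
  define f where "f s = c k + (\<Sum>i\<in>I. c i * exp ((a i - a k) * s))" for s
  define f' where "f' s = (\<Sum>i\<in>I. (c i * (a i - a k)) * exp ((a i - a k) * s))" for s
  have "f s = 0" if "s \<in> S" for s
  proof -
    have "(\<Sum>i\<in>insert k I. c i * exp (a i * s)) = exp (a k * s) * f s"
      using insert.hyps
      by (simp add: f_def algebra_simps exp_diff sum_distrib_left)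
    then show ?thesis using insert.prems(4)[OF that] by simp
  qed
  moreover have "(f has_real_derivative f' s) (at s)" for s
    unfolding f_def f'_def
    by (rule derivative_eq_intros refl | simp add: algebra_simps)+
  ultimately obtain S' where S': "finite S'" "card S \<le> Suc (card S')" "\<forall>s\<in>S'. f' s = 0"
    using Rolle_finite[OF insert.prems(2)] by blast
  have "\<forall>i\<in>I. c i * (a i - a k) = 0"
    using insert.hyps insert.prems S'
    by (intro insert.IH[of "\<lambda>i. a i - a k" S']) (auto simp: inj_on_def f'_def)
  moreover have "a i \<noteq> a k" if "i \<in> I" for i
    using insert.hyps insert.prems(1) that by (metis inj_onD insertCI)
  ultimately have I: "\<forall>i\<in>I. c i = 0" by auto
  \<comment> \<open>Only the \<open>k\<close>-th term is left, so a single zero forces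
    \<open>c k = 0\<close>.\<close>
  from insert.prems(3) insert.hyps have "S \<noteq> {}" by auto
  then obtain s where "s \<in> S" by blast
  then show ?case using insert.prems(4)[of s] insert.hyps I by simp
qed

text \<open>A linear relation between the rows is an exponential sum with exponents
  \<open>a i\<close> that vanishes at all points of \<open>range b\<close>, which are as many as its
  terms.\<close>

lemma det_exp_nonzero:
  fixes a b :: "'n::finite \<Rightarrow> real"
  assumes "inj a" and "inj b"
  shows "det (\<chi> i j. exp (a i * b j)) \<noteq> 0"
proof -
  let ?E = "(\<chi> i j. exp (a i * b j)) :: real^'n^'n"
  have "\<forall>i. c i = 0" if "(\<Sum>i\<in>UNIV. c i *s row i ?E) = 0" for c
  proof -
    have zero: "(\<Sum>i\<in>UNIV. c i * exp (a i * b j)) = 0" for j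
      using arg_cong[OF that, of "\<lambda>v. v $ j"] by (simp add: row_def)
    have "\<forall>i\<in>UNIV. c i = 0"
    proof (rule exp_sum_zeros)
      show "card (UNIV :: 'n set) \<le> card (range b)"
        using assms(2) by (simp add: card_image)
    qed (use assms(1) zero in auto)
    then show ?thesis by simp
  qed
  then have "invertible ?E"
    unfolding invertible_right_inverse matrix_right_invertible_independent_rows by blast
  then show ?thesis by (simp add: invertible_det_nz)
qed

text \<open>Strict rearrangement inequality, from expanding the positive sum of the squares
  \<open>(a i - a (p i))\<^sup>2\<close>. It makes the identity the dominant permutation in the
  determinant below.\<close>

lemma sum_mult_permutes_less:
  fixes a :: "'n::finite \<Rightarrow> real"
  assumes "inj a" and p: "p permutes UNIV" and "p \<noteq> id"
  shows "(\<Sum>i\<in>UNIV. a i * a (p i)) < (\<Sum>i\<in>UNIV. a i * a i)"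
proof -
  obtain k where k: "p k \<noteq> k" using \<open>p \<noteq> id\<close> by (auto simp: fun_eq_iff)
  have "0 < (\<Sum>i\<in>UNIV. (a i - a (p i))\<^sup>2)"
    using k injD[OF \<open>inj a\<close>, of k "p k"] by (intro sum_pos2[of _ k]) auto
  also have "\<dots> = (\<Sum>i\<in>UNIV. a i * a i) + (\<Sum>i\<in>UNIV. a (p i) * a (p i))
      - 2 * (\<Sum>i\<in>UNIV. a i * a (p i))"
    by (simp add: power2_eq_square algebra_simps sum.distrib sum_subtractf sum_distrib_left)
  also have "(\<Sum>i\<in>UNIV. a (p i) * a (p i)) = (\<Sum>i\<in>UNIV. a i * a i)"
    using sum.permute[OF p, of "\<lambda>i. a i * a i"] by (simp add: o_def)
  finally show ?thesis by simp
qed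

lemma det_exp_pos:
  fixes a b :: "'n::{finite,linorder} \<Rightarrow> real"
  assumes a: "strict_mono a" and b: "strict_mono b"
  shows "det (\<chi> i j. exp (a i * b j)) > 0"
proof -
  define F where "F s = det (\<chi> i j. exp (a i * (b j + s * a j)))" for s :: real
  define P where "P = {p. p permutes (UNIV::'n set)}"
  define Q where "Q = (\<Sum>i\<in>UNIV. a i * a i)"
  define A where "A p = (\<Sum>i\<in>UNIV. a i * b (p i))" for p
  define B where "B p = (\<Sum>i\<in>UNIV. a i * a (p i))" for p
  have finP: "finite P" by (simp add: P_def finite_permutations)
  have idP: "id \<in> P" by (simp add: P_def permutes_id)
  \<comment> \<open>In the Leibniz expansion the growth rate in \<open>s\<close> of the term of
    \<open>p\<close> is \<open>B p\<close>, whose strict maximum \<open>Q\<close> is attained at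
    \<open>id\<close> only.\<close>
  have F: "F s = (\<Sum>p\<in>P. of_int (sign p) * exp (A p + s * B p))" for s
    unfolding F_def det_def P_def A_def B_def
    by (simp add: exp_sum[symmetric] algebra_simps sum.distrib sum_distrib_left)
  have nz: "F s \<noteq> 0" if "s \<ge> 0" for s
    unfolding F_def
  proof (rule det_exp_nonzero)
    show "inj a" using a by (rule strict_mono_imp_inj_on)
    have "strict_mono (\<lambda>j. b j + s * a j)"
    proof (rule strict_monoI)
      fix i j :: 'n assume "i < j"
      then have "b i < b j" "a i \<le> a j"
        using a b by (auto simp: strict_mono_def less_imp_le)
      then show "b i + s * a i < b j + s * a j"
        using that by (intro add_less_le_mono mult_left_mono)
    qed
    then show "inj (\<lambda>j. b j + s * a j)" by (rule strict_mono_imp_inj_on)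
  qed
  \<comment> \<open>This is \<open>F s\<close> divided by \<open>exp (s * Q)\<close>: the identity
    term stays constant and all others decay.\<close>
  have lim: "((\<lambda>s. \<Sum>p\<in>P. of_int (sign p) * (exp (A p) * exp (- (s * (Q - B p)))))
      \<longlongrightarrow> (\<Sum>p\<in>P. if p = id then exp (A id) else 0)) at_top"
  proof (intro tendsto_sum)
    fix p assume p: "p \<in> P"
    show "((\<lambda>s. of_int (sign p) * (exp (A p) * exp (- (s * (Q - B p)))))
      \<longlongrightarrow> (if p = id then exp (A id) else 0)) at_top"
    proof (cases "p = id")
      case True
      then show ?thesis by (simp add: Q_def B_def sign_id)
    next
      case False
      then have "Q - B p > 0"
        using sum_mult_permutes_less[OF strict_mono_imp_inj_on[OF a]] p
        by (auto simp: P_def Q_def B_def)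
      then have "filterlim (\<lambda>s. s * (Q - B p)) at_top at_top"
        by (intro filterlim_at_top_mult_tendsto_pos[OF tendsto_const _ filterlim_ident])
      then have "((\<lambda>s. exp (- (s * (Q - B p)))) \<longlongrightarrow> 0) at_top"
        by (intro filterlim_compose[OF exp_at_bot] filterlim_compose[OF filterlim_uminus_at_bot_at_top])
      then have "((\<lambda>s. of_int (sign p) * (exp (A p) * exp (- (s * (Q - B p)))))
          \<longlongrightarrow> of_int (sign p) * (exp (A p) * 0)) at_top"
        by (intro tendsto_intros)
      with False show ?thesis by simp
    qed
  qed
  have "(\<Sum>p\<in>P. if p = id then exp (A id) else 0) = exp (A id)"
    using finP idP by simp
  then have "\<forall>\<^sub>F s in at_top. 0 < (\<Sum>p\<in>P. of_int (sign p) * (exp (A p) * exp (- (s * (Q - B p)))))"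
    using order_tendstoD(1)[OF lim, of 0] by simp
  then have "\<forall>\<^sub>F s in at_top. 0 < (\<Sum>p\<in>P. of_int (sign p) * (exp (A p) * exp (- (s * (Q - B p))))) \<and> s \<ge> 0"
    using eventually_ge_at_top[of 0] by eventually_elim simp
  then obtain s where s: "s \<ge> 0"
    "0 < (\<Sum>p\<in>P. of_int (sign p) * (exp (A p) * exp (- (s * (Q - B p)))))"
    by (auto dest: eventually_happens)
  have "exp (A p + s * B p) = exp (s * Q) * (exp (A p) * exp (- (s * (Q - B p))))" for p
    by (simp add: mult_exp_exp right_diff_distrib)
  then have "F s = exp (s * Q) * (\<Sum>p\<in>P. of_int (sign p) * (exp (A p) * exp (- (s * (Q - B p)))))"
    by (simp add: F sum_distrib_left mult.left_commute)
  with s have Fs: "F s > 0" by simp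
  \<comment> \<open>\<open>F\<close> is continuous without zeros on \<open>{0..s}\<close>, so the
    sign at \<open>s\<close> carries back to \<open>0\<close>, where \<open>F\<close> is the
    determinant in question.\<close>
  have "F 0 > 0"
  proof (rule ccontr)
    assume "\<not> F 0 > 0"
    moreover have "continuous_on {0..s} F"
      unfolding F by (intro continuous_intros)
    ultimately obtain u where "0 \<le> u" "u \<le> s" "F u = 0"
      using IVT'[of F 0 0 s] s(1) Fs by auto
    with nz show False by blast
  qed
  then show ?thesis by (simp add: F_def)
qed

section \<open>The Karlin-McGregor determinant: expansion and positivity\<close>

lemma km_density_sum:
  fixes x y :: "real ^ 'n::{finite,linorder}"
  assumes "t > 0"
  shows "km_density t y x = (\<Sum>p | p permutes UNIV.
    of_int (sign p) * (\<Prod>i\<in>UNIV. normal_density (x $ p i) (sqrt t) (y $ i)))"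
proof -
  have "(2 * pi * t) powr (- 1 / 2) = 1 / sqrt (2 * pi * t)"
    using assms powr_minus_divide[of "2 * pi * t" "1 / 2"] by (simp add: powr_half_sqrt)
  then have "(2 * pi * t) powr (- 1 / 2) * exp (- ((x $ j - y $ i)\<^sup>2) / (2 * t)) =
      normal_density (x $ j) (sqrt t) (y $ i)" for i j
    using assms power2_commute[of "x $ j" "y $ i"] by (simp add: normal_density_def)
  then show ?thesis by (simp add: km_density_def det_def)
qed

lemma km_density_pos:
  fixes x y :: "real ^ 'n::{finite,linorder}"
  assumes "t > 0" and x: "x \<in> weyl_chamber" and y: "y \<in> weyl_chamber"
  shows "km_density t y x > 0"
proof -
  define C where "C = (2 * pi * t) powr (- 1 / 2)"
  define u where "u i = exp (- (y $ i)\<^sup>2 / (2 * t))" for i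
  define v where "v j = exp (- (x $ j)\<^sup>2 / (2 * t))" for j
  \<comment> \<open>Expanding the square separates positive row and column factors from the
    exponential kernel in \<open>y $ i / t\<close> and \<open>x $ j\<close>.\<close>
  have entry: "C * exp (- ((x $ j - y $ i)\<^sup>2) / (2 * t)) =
      (C * u i) * (v j * exp (y $ i / t * x $ j))" for i j
    using \<open>t > 0\<close>
    by (simp add: u_def v_def exp_add[symmetric] field_simps power2_eq_square)
  have "km_density t y x = (\<Prod>i\<in>UNIV. C * u i) * det (\<chi> i j. v j * exp (y $ i / t * x $ j))"
    unfolding km_density_def C_def[symmetric] entry
    using det_rows_mul[of "\<lambda>i. C * u i" "\<lambda>i. \<chi> j. v j * exp (y $ i / t * x $ j)"]
    by (simp add: vector_scalar_mult_def)
  \<comment> \<open>Transposing turns the column factors \<open>v j\<close> into row factors, so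
    that \<open>det_rows_mul\<close> extracts them too.\<close>
  also have "det (\<chi> i j. v j * exp (y $ i / t * x $ j)) =
      det (\<chi> j i. v j * exp (y $ i / t * x $ j))"
    by (subst det_transpose[symmetric]) (simp add: transpose_def)
  also have "\<dots> = (\<Prod>j\<in>UNIV. v j) * det (\<chi> j i. exp (x $ j * (y $ i / t)))"
    using det_rows_mul[of v "\<lambda>j. \<chi> i. exp (y $ i / t * x $ j)"]
    by (simp add: vector_scalar_mult_def mult.commute)
  also have "(\<Prod>i\<in>UNIV. C * u i) * \<dots> > 0"
    using assms
    by (intro mult_pos_pos prod_pos det_exp_pos)
      (auto simp: C_def u_def v_def weyl_chamber_def strict_mono_def divide_strict_right_mono)
  finally show ?thesis .
qed

section \<open>Integrability of the determinant and positivity of its integral over the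
  chamber\<close>

lemma integrable_prod_vec:
  fixes f :: "'n::finite \<Rightarrow> real \<Rightarrow> real"
  assumes "\<And>i. integrable lborel (f i)"
  shows "integrable lborel (\<lambda>x::real^'n. \<Prod>i\<in>UNIV. f i (x $ i))"
proof -
  have meas: "f i \<in> borel_measurable borel" for i
    using assms[of i] by (auto dest: borel_measurable_integrable)
  \<comment> \<open>The factors are reindexed by basis vectors to match
    \<open>nn_integral_lborel_prod\<close>. Off the basis \<open>THE\<close> still denotes some
    index, so every \<open>g b\<close> is one of the \<open>f i\<close> and inherits measurability
    and integrability.\<close>
  define g where "g b = f (THE i. b = axis i (1::real))" for b :: "real^'n"
  have g: "g (axis i 1) = f i" for i
    by (simp add: g_def axis_eq_axis)
  have Basis: "(Basis :: (real^'n) set) = range (\<lambda>i. axis i 1)"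
    by (auto simp: Basis_vec_def)
  have inj: "inj (\<lambda>i::'n. axis i (1::real))"
    by (auto simp: inj_on_def axis_eq_axis)
  have gm: "g b \<in> borel_measurable borel" for b
    using meas by (simp add: g_def)
  have eq: "(\<Prod>b\<in>Basis. g b (x \<bullet> b)) = (\<Prod>i\<in>UNIV. f i (x $ i))" for x
    unfolding Basis by (simp add: prod.reindex[OF inj] o_def g inner_axis)
  have "(\<integral>\<^sup>+x. (\<Prod>b\<in>Basis. ennreal \<bar>g b (x \<bullet> b)\<bar>) \<partial>lborel) =
      (\<Prod>b\<in>Basis. (\<integral>\<^sup>+x. ennreal \<bar>g b x\<bar> \<partial>lborel))"
    using gm by (intro nn_integral_lborel_prod) auto
  also have "\<dots> < \<infinity>"
    using assms
    by (auto simp: ennreal_prod_eq_top g_def integrable_iff_bounded less_top[symmetric])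
  finally have "integrable lborel (\<lambda>x. \<Prod>b\<in>Basis. g b (x \<bullet> b))"
    using gm by (auto simp: integrable_iff_bounded abs_prod prod_ennreal)
  then show ?thesis by (simp add: eq)
qed

lemma integrable_km_density:
  fixes x :: "real ^ 'n::{finite,linorder}"
  assumes "t > 0"
  shows "integrable lborel (\<lambda>y. km_density t y x)"
  \<comment> \<open>Each Leibniz term is a constant times a product of normal densities in separate
    coordinates of \<open>y\<close>.\<close>
  unfolding km_density_sum[OF assms]
  using assms
  by (intro Bochner_Integration.integrable_sum integrable_mult_right integrable_prod_vec) auto

lemma open_weyl_chamber: "open (weyl_chamber :: (real ^ 'n::{finite,linorder}) set)"
proof -
  have eq: "(weyl_chamber :: (real, 'n) vec set) = (\<Inter>(i, j)\<in>{(i, j). i < j}. {x. x $ i < x $ j})"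
    by (auto simp: weyl_chamber_def)
  show ?thesis
    unfolding eq by (intro open_INT) (auto intro!: open_Collect_less continuous_intros)
qed

text \<open>For \<open>t > 0\<close> the integrand is strictly positive on the chamber, so a zero
  integral would make the chamber a null set. But it is open and contains \<open>x\<close>.\<close>

lemma noncolliding_prob_pos:
  fixes x :: "real ^ 'n::{finite,linorder}"
  assumes "t \<ge> 0" and x: "x \<in> weyl_chamber"
  shows "noncolliding_prob t x > 0"
proof (cases "t = 0")
  case True
  then show ?thesis by (simp add: noncolliding_prob_def)
next
  case False
  with assms have t: "t > 0" by simp
  let ?W = "weyl_chamber :: (real ^ 'n::{finite,linorder}) set"
  let ?f = "\<lambda>y. indicat_real ?W y *\<^sub>R km_density t y x"
  have W: "?W \<in> sets lborel"
    using borel_open[OF open_weyl_chamber] by simp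
  have int: "integrable lborel ?f"
    using W by (intro integrable_mult_indicator integrable_km_density t)
  have nonneg: "?f y \<ge> 0" for y
    using km_density_pos[OF t x, of y] by (auto simp: indicator_def)
  have "integral\<^sup>L lborel ?f \<noteq> 0"
  proof
    assume "integral\<^sup>L lborel ?f = 0"
    then have "AE y in lborel. ?f y = 0"
      using integral_nonneg_eq_0_iff_AE[OF int] nonneg by simp
    then have "AE y in lborel. y \<notin> ?W"
      by eventually_elim (use km_density_pos[OF t x] in \<open>force simp: indicator_def\<close>)
    then have "?W \<in> null_sets lborel"
      using AE_iff_null_sets[OF W] by simp
    then have "negligible ?W"
      by (simp add: negligible_iff_null_sets null_sets_completionI)
    then show False
      using open_not_negligible[OF open_weyl_chamber] x by blast
  qed
  moreover have "integral\<^sup>L lborel ?f \<ge> 0"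
    using nonneg by (intro integral_nonneg_AE) auto
  ultimately show ?thesis
    using t by (simp add: noncolliding_prob_def set_lebesgue_integral_def)
qed

section \<open>Constants and telescoping\<close>

lemma vandermonde_pos: "x \<in> weyl_chamber \<Longrightarrow> vandermonde x > 0"
  unfolding vandermonde_def by (intro prod_pos) (auto simp: weyl_chamber_def)

text \<open>The constant in the relation is the ratio of the two normalisations at the origin: the
  powers of \<open>pi\<close> and the factors \<open>Gamma (real j)\<close> cancel.\<close>

lemma c_const_eq: "c_const N = cbar_const N * c'_const N"
proof -
  have "(\<Prod>j=1..N. Gamma (real j)) \<noteq> 0"
    by (auto simp: Gamma_eq_zero_iff)
  moreover have "pi powr (real N / 2) * (2 * pi) powr (- real N / 2) = 2 powr (- real N / 2)"
    by (simp add: powr_mult powr_minus field_simps)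
  ultimately show ?thesis
    by (simp add: c_const_def cbar_const_def c'_const_def prod_dividef mult.commute mult.left_commute)
qed

theorem mainTheorem5:
  fixes l :: nat and T :: real and t :: "nat \<Rightarrow> real"
    and y :: "nat \<Rightarrow> real ^ 'n::{finite,linorder}"
  assumes "l \<ge> 1" and "T > 0"
    and "t 0 = 0" and "t l = T" and "\<And>i. i < l \<Longrightarrow> t i < t (Suc i)"
    and "y 0 = 0" and "\<And>i. i \<in> {1..l} \<Longrightarrow> y i \<in> weyl_chamber"
  shows "(\<Prod>i=1..l. g_density T (t (i - 1)) (y (i - 1)) (t i) (y i)) =
    cbar_const CARD('n) * T powr (real CARD('n) * (real CARD('n) - 1) / 4) *
    (\<Prod>i=1..l. p_density (t (i - 1)) (y (i - 1)) (t i) (y i)) * (1 / vandermonde (y l))"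
proof -
  define K where "K = T powr (real CARD('n) * (real CARD('n) - 1) / 4)"
  define g where "g i = g_density T (t (i - 1)) (y (i - 1)) (t i) (y i)" for i
  define p where "p i = p_density (t (i - 1)) (y (i - 1)) (t i) (y i)" for i
  have mono: "t i \<le> t j" if "i \<le> j" "j \<le> l" for i j
    using that
  proof (induction j rule: dec_induct)
    case (step m)
    with assms(5)[of m] show ?case by simp
  qed simp
  \<comment> \<open>Invariant of the telescoping: after \<open>m\<close> steps the two products
    differ by the constants and by the uncancelled end factors at \<open>y m\<close>.\<close>
  have "(\<Prod>i=1..m. g i) * vandermonde (y m) =
      cbar_const CARD('n) * K * (\<Prod>i=1..m. p i) * noncolliding_prob (T - t m) (y m)"
    if "1 \<le> m" "m \<le> l" for m
    using that
  proof (induction m rule: dec_induct)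
    \<comment> \<open>The first step starts at the origin; the factor
      \<open>vandermonde (y 1)\<close> on the left supplies the second power of the Vandermonde
      product in \<open>p\<close>.\<close>
    case base
    show ?case
      using assms(3,6)
      by (simp add: g_def p_def g_density_def p_density_def c_const_eq K_def power2_eq_square)
  next
    case (step m)
    \<comment> \<open>A positive starting time selects the second branch of both densities, even if
      \<open>y m = 0\<close>, which is possible for \<open>N = 1\<close>.\<close>
    have "t m > 0"
      using assms(3) assms(5)[of 0] mono[of 1 m] step by simp
    then have steps:
      "g (Suc m) = km_density (t (Suc m) - t m) (y (Suc m)) (y m)
          * noncolliding_prob (T - t (Suc m)) (y (Suc m)) / noncolliding_prob (T - t m) (y m)"
      "p (Suc m) = 1 / vandermonde (y m) * km_density (t (Suc m) - t m) (y (Suc m)) (y m)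
          * vandermonde (y (Suc m))"
      by (simp_all add: g_def p_def g_density_def p_density_def)
    have pos: "vandermonde (y m) > 0" "noncolliding_prob (T - t m) (y m) > 0"
      using step assms(4) mono[of m l] assms(7)[of m]
      by (auto intro!: vandermonde_pos noncolliding_prob_pos)
    \<comment> \<open>In this form the factor \<open>noncolliding_prob (T - t m) (y m)\<close>
      cancels the denominator of \<open>g (Suc m)\<close>, and \<open>1 / vandermonde (y m)\<close>
      is absorbed into \<open>p (Suc m)\<close>.\<close>
    have "(\<Prod>i=1..m. g i) = cbar_const CARD('n) * K * (\<Prod>i=1..m. p i)
        * noncolliding_prob (T - t m) (y m) / vandermonde (y m)"
      using step pos by (simp add: field_simps)
    then show ?case
      using pos by (simp add: steps)
  qed
  \<comment> \<open>At \<open>m = l\<close> the remaining time is \<open>T - t l = 0\<close>, where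
    \<open>noncolliding_prob\<close> is \<open>1\<close> by definition.\<close>
  from this[of l] have "(\<Prod>i=1..l. g i) * vandermonde (y l) =
      cbar_const CARD('n) * K * (\<Prod>i=1..l. p i)"
    using assms(1,4) by (simp add: noncolliding_prob_def)
  moreover have "vandermonde (y l) > 0"
    using assms(1,7) by (intro vandermonde_pos) auto
  ultimately show ?thesis
    by (simp add: g_def p_def K_def field_simps)
qed

end
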